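(* For $(\epsilon_1,\epsilon_2,\epsilon_3,\epsilon_4)\in(0,\tfrac12)^4$ consider the conditions: (a) $\epsilon_1+\epsilon_2+\epsilon_3+\epsilon_4<1/2$; (b) $\epsilon_1+\epsilon_2+\epsilon_3+\epsilon_4>3/2$; (c) $\epsilon_i+\epsilon_j-\epsilon_k-\epsilon_l>1/2$ for some renumbering $\{i,j,k,l\}=\{1,2,3,4\}$ (six conditions). The condition "(a) or (b) or (c)" is left invariant under any pair of elementary transformations at two distinct points $t_i,t_j$, i.e. under $\epsilon_i\mapsto\frac12-\epsilon_i$, $\epsilon_j\mapsto\frac12-\epsilon_j$ ($i\ne j$), the other two $\epsilon$'s being fixed; and these operations permute transitively the $8$ zones defined by (a), (b) and the six conditions (c).
   Context: The numbers $\epsilon_i=(\alpha_i^+-\alpha_i^-)/2$ come from parabolic weights $\alpha_i^-<\alpha_i^+<\alpha_i^-+1$ at four points $t_1,\dots,t_4$ of $\mathbb P^1$ on a rank 2 bundle. The elementary transformation at $t_i$ of $(E,P_\bullet)$ replaces $E$ by $\ker(E\to E_{t_i}/P_i)$, and the weights at $t_i$ by $\tilde\alpha_i^+=\alpha_i^-$, $\tilde\alpha_i^-=\alpha_i^+-1$, so that $\tilde\epsilon_i=\frac12-\epsilon_i$. Two elementary transformations are performed at a time (followed by tensoring with a line bundle) in order to keep an odd degree. The 8 zones are the subsets of $(0,\frac12)^4$ defined by (a), by (b), and by each of the six inequalities in (c) (one for each two-element subset $\{i,j\}$). *)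

theory Defs
  imports "HOL-Analysis.Analysis"
begin

text \<open>The points \<open>t\<^sub>1, \<dots>, t\<^sub>4\<close> are indexed by the four-element type \<open>4\<close>, whose elements are
  \<open>1, 2, 3\<close> and \<open>4 = 0\<close>. A system of weights is the pair \<open>(\<alpha>\<^sup>+, \<alpha>\<^sup>-)\<close>.\<close>

type_synonym weights = "(real^4) \<times> (real^4)"

definition parabolic_weights :: "weights set" where
  "parabolic_weights = {(ap, am). \<forall>i. am $ i < ap $ i \<and> ap $ i < am $ i + 1}"

definition eps :: "weights \<Rightarrow> real^4" where
  "eps = (\<lambda>(ap, am). \<chi> i. (ap $ i - am $ i) / 2)"

text \<open>Effect on the weights of the elementary transformation at \<open>t\<^sub>i\<close>. Tensoring with a line bundle
  changes the degree of the bundle but not the weights, hence does not appear.\<close>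

definition elem_weights :: "4 \<Rightarrow> weights \<Rightarrow> weights" where
  "elem_weights i = (\<lambda>(ap, am).
     (\<chi> k. if k = i then am $ k else ap $ k,
      \<chi> k. if k = i then ap $ k - 1 else am $ k))"

definition elem_pair :: "4 \<Rightarrow> 4 \<Rightarrow> real^4 \<Rightarrow> real^4" where
  "elem_pair i j \<epsilon> = (\<chi> k. if k = i \<or> k = j then 1/2 - \<epsilon> $ k else \<epsilon> $ k)"

definition eps_cube :: "(real^4) set" where
  "eps_cube = {\<epsilon>. \<forall>i. 0 < \<epsilon> $ i \<and> \<epsilon> $ i < 1/2}"

definition cond_a :: "real^4 \<Rightarrow> bool" where
  "cond_a \<epsilon> \<longleftrightarrow> \<epsilon> $ 1 + \<epsilon> $ 2 + \<epsilon> $ 3 + \<epsilon> $ 4 < 1/2"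

definition cond_b :: "real^4 \<Rightarrow> bool" where
  "cond_b \<epsilon> \<longleftrightarrow> \<epsilon> $ 1 + \<epsilon> $ 2 + \<epsilon> $ 3 + \<epsilon> $ 4 > 3/2"

definition renumbering :: "4 \<Rightarrow> 4 \<Rightarrow> 4 \<Rightarrow> 4 \<Rightarrow> bool" where
  "renumbering i j k l \<longleftrightarrow> {i, j, k, l} = {1, 2, 3, 4}"

definition ineq_c :: "4 \<Rightarrow> 4 \<Rightarrow> 4 \<Rightarrow> 4 \<Rightarrow> real^4 \<Rightarrow> bool" where
  "ineq_c i j k l \<epsilon> \<longleftrightarrow> \<epsilon> $ i + \<epsilon> $ j - \<epsilon> $ k - \<epsilon> $ l > 1/2"

definition cond_c :: "real^4 \<Rightarrow> bool" where
  "cond_c \<epsilon> \<longleftrightarrow> (\<exists>i j k l. renumbering i j k l \<and> ineq_c i j k l \<epsilon>)"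

definition zone_a :: "(real^4) set" where
  "zone_a = {\<epsilon> \<in> eps_cube. cond_a \<epsilon>}"

definition zone_b :: "(real^4) set" where
  "zone_b = {\<epsilon> \<in> eps_cube. cond_b \<epsilon>}"

definition zones_c :: "(real^4) set set" where
  "zones_c = {{\<epsilon> \<in> eps_cube. ineq_c i j k l \<epsilon>} | i j k l. renumbering i j k l}"

definition zones :: "(real^4) set set" where
  "zones = {zone_a, zone_b} \<union> zones_c"

text \<open>The group generated by the pairs of elementary transformations. Inverses need not be added,
  since \<open>elem_pair i j\<close> is an involution.\<close>

inductive_set elem_group :: "(real^4 \<Rightarrow> real^4) set" where
  elem_group_id: "id \<in> elem_group"
| elem_group_step: "g \<in> elem_group \<Longrightarrow> i \<noteq> j \<Longrightarrow> elem_pair i j \<circ> g \<in> elem_group"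

end

(* Write \<epsilon>\<^sup>S for the point obtained from \<epsilon> by replacing \<epsilon>\<^sub>k by 1/2 - \<epsilon>\<^sub>k for all k in S.
   The eight zones are exactly the sets Z\<^sub>S on which the coordinates of \<epsilon>\<^sup>S add up to less than
   1/2, where S is a set of indices of even size: S empty gives (a), S everything gives (b),
   S = {i, j} gives one of the conditions (c). Since (\<epsilon>\<^sup>S)\<^sup>T is \<epsilon> flipped along the symmetric difference of
   S and T, flipping along T maps Z\<^sub>S onto the zone of that symmetric difference, so the flips along even
   sets act on the zones like the group of even subsets acts on itself by translation. *)

theory Submission
  imports Defs
begin

section \<open>Flips along sets of indices and the zones they permute\<close>

definition flip :: "4 set \<Rightarrow> real^4 \<Rightarrow> real^4" where
  "flip S \<epsilon> = (\<chi> k. if k \<in> S then 1/2 - \<epsilon> $ k else \<epsilon> $ k)"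

definition zone :: "4 set \<Rightarrow> (real^4) set" where
  "zone S = {\<epsilon> \<in> eps_cube. (\<Sum>k\<in>UNIV. flip S \<epsilon> $ k) < 1/2}"

lemma elem_pair_eq_flip: "elem_pair i j = flip {i, j}"
  by (auto simp: elem_pair_def flip_def fun_eq_iff vec_eq_iff)

lemma flip_empty: "flip {} = id"
  by (auto simp: flip_def fun_eq_iff vec_eq_iff)

lemma flip_flip: "flip S (flip T \<epsilon>) = flip (sym_diff S T) \<epsilon>"
  by (auto simp: flip_def vec_eq_iff)

lemma flip_involution: "flip S (flip S \<epsilon>) = \<epsilon>"
  by (simp add: flip_flip flip_empty)

lemma flip_in_cube: "\<epsilon> \<in> eps_cube \<Longrightarrow> flip S \<epsilon> \<in> eps_cube"
  by (auto simp: flip_def eps_cube_def)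

text \<open>Flipping \<open>flip T \<epsilon>\<close> along \<open>sym_diff S T\<close> cancels
  \<open>T\<close> and leaves \<open>flip S \<epsilon>\<close>, so both memberships bound the same
  sum.\<close>

lemma flip_in_zone:
  assumes "\<epsilon> \<in> zone S"
  shows "flip T \<epsilon> \<in> zone (sym_diff S T)"
proof -
  have "sym_diff (sym_diff S T) T = S"
    by blast
  then show ?thesis
    using assms by (simp add: zone_def flip_flip flip_in_cube)
qed

lemma flip_image_zone: "flip T ` zone S = zone (sym_diff S T)"
proof
  show "flip T ` zone S \<subseteq> zone (sym_diff S T)"
    using flip_in_zone by blast
  show "zone (sym_diff S T) \<subseteq> flip T ` zone S"
  proof
    fix \<epsilon> assume "\<epsilon> \<in> zone (sym_diff S T)"
    then have "flip T \<epsilon> \<in> zone (sym_diff (sym_diff S T) T)"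
      by (rule flip_in_zone)
    moreover have "sym_diff (sym_diff S T) T = S"
      by blast
    ultimately show "\<epsilon> \<in> flip T ` zone S"
      by (metis flip_involution imageI)
  qed
qed

section \<open>Sets of even size; distinct sets give distinct zones\<close>

lemma even_card_sym_diff:
  assumes "finite S" "finite T"
  shows "even (card (sym_diff S T)) \<longleftrightarrow> (even (card S) \<longleftrightarrow> even (card T))"
proof -
  have "card (sym_diff S T) = card (S - T) + card (T - S)"
    using assms by (intro card_Un_disjoint) auto
  moreover have "card S = card (S - T) + card (S \<inter> T)"
    using assms card_Int_Diff[of S T] by simp
  moreover have "card T = card (T - S) + card (S \<inter> T)"
    using assms card_Int_Diff[of T S] by (simp add: Int_commute)
  ultimately show ?thesis
    by auto
qed

lemma even_card_4_cases:
  fixes S :: "4 set"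
  shows "even (card S) \<longleftrightarrow> S = {} \<or> S = UNIV \<or> card S = 2"
proof
  assume "even (card S)"
  moreover have "card S \<le> 4"
    using card_mono[of UNIV S] by simp
  ultimately have "card S = 0 \<or> card S = 2 \<or> card S = 4"
    by presburger
  then show "S = {} \<or> S = UNIV \<or> card S = 2"
    using card_eq_UNIV_imp_eq_UNIV[of S] by auto
qed auto

(* The point close to the vertex of the cube given by S lies in the zone of S and in no other one. *)
lemma inj_zone: "inj zone"
proof (rule injI)
  fix S T assume eq: "zone S = zone T"
  \<comment> \<open>A flip turns 1/16 into 7/16. With no flip the coordinates add up to 1/4, below
    the bound 1/2; one flipped coordinate already forces at least 7/16 + 3/16 = 5/8.\<close>
  define p :: "real^4" where "p = flip S (\<chi> k. 1/16)"
  have "(\<chi> k. 1/16) \<in> eps_cube"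
    by (simp add: eps_cube_def)
  then have "p \<in> zone S"
    by (simp add: p_def zone_def flip_involution flip_in_cube)
  then have "p \<in> zone T"
    using eq by simp
  then have less: "(\<Sum>k\<in>UNIV. flip (sym_diff T S) (\<chi> k. 1/16) $ k) < 1/2"
    by (simp add: zone_def p_def flip_flip)
  have ge: "(\<Sum>k\<in>UNIV. flip D (\<chi> k. 1/16) $ k) \<ge> 5/8" if "m \<in> D" for D and m :: 4
  proof -
    have "(\<Sum>k\<in>UNIV - {m}. flip D (\<chi> k. 1/16) $ k) \<ge> of_nat (card (UNIV - {m})) * (1/16)"
      by (rule sum_bounded_below) (simp add: flip_def)
    moreover have "flip D (\<chi> k. 1/16) $ m = 7/16"
      using that by (simp add: flip_def)
    ultimately show ?thesis
      by (simp add: sum.remove[of UNIV m])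
  qed
  have "m \<notin> sym_diff T S" for m
    using less ge[of m "sym_diff T S"] by linarith
  then show "S = T"
    by blast
qed

section \<open>The conditions (a), (b), (c) in terms of \<open>zone\<close>\<close>

lemma zone_a_eq: "zone_a = zone {}"
  by (simp add: zone_a_def cond_a_def zone_def flip_empty sum_4)

text \<open>Flipping all four coordinates turns their sum s into 2 - s, and 2 - s < 1/2 means s >
  3/2.\<close>

lemma zone_b_eq: "zone_b = zone UNIV"
  by (auto simp: zone_b_def cond_b_def zone_def flip_def sum_4)

text \<open>Four indices that exhaust a type with four elements are distinct. This form separates
  the pair that determines the zone from its complement.\<close>

lemma renumbering_iff: "renumbering i j k l \<longleftrightarrow> i \<noteq> j \<and> k \<noteq> l \<and> - {i, j} = {k, l}"
proof
  assume "renumbering i j k l"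
  then have U: "{i, j, k, l} = UNIV"
    by (simp add: renumbering_def UNIV_4)
  then have "card {i, j, k, l} = 4"
    by simp
  then have "distinct [i, j, k, l]"
    by (intro card_distinct) simp
  with U show "i \<noteq> j \<and> k \<noteq> l \<and> - {i, j} = {k, l}"
    by auto
next
  assume "i \<noteq> j \<and> k \<noteq> l \<and> - {i, j} = {k, l}"
  then have "{i, j, k, l} = UNIV"
    by blast
  then show "renumbering i j k l"
    by (simp add: renumbering_def UNIV_4)
qed

text \<open>The flipped coordinates add up to 1 - x, where x is the left side of
  \<open>ineq_c i j k l \<epsilon>\<close>, and 1 - x < 1/2 means x > 1/2.\<close>

lemma zone_pair_eq:
  assumes "renumbering i j k l"
  shows "{\<epsilon> \<in> eps_cube. ineq_c i j k l \<epsilon>} = zone {i, j}"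
proof -
  have d: "i \<noteq> j" "k \<noteq> l" "- {i, j} = {k, l}"
    using assms by (auto simp: renumbering_iff)
  have "(\<Sum>m\<in>UNIV. flip {i, j} \<epsilon> $ m) = 1 - \<epsilon> $ i - \<epsilon> $ j + \<epsilon> $ k + \<epsilon> $ l" for \<epsilon>
  proof -
    have "(\<Sum>m\<in>UNIV. flip {i, j} \<epsilon> $ m)
        = (\<Sum>m\<in>{i, j}. flip {i, j} \<epsilon> $ m) + (\<Sum>m\<in>- {i, j}. flip {i, j} \<epsilon> $ m)"
      using sum.subset_diff[of "{i, j}" UNIV "\<lambda>m. flip {i, j} \<epsilon> $ m"]
      by (simp add: Compl_eq_Diff_UNIV)
    also have "(\<Sum>m\<in>- {i, j}. flip {i, j} \<epsilon> $ m) = (\<Sum>m\<in>- {i, j}. \<epsilon> $ m)"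
      by (rule sum.cong) (auto simp: flip_def)
    finally show ?thesis
      using d(1,2) unfolding d(3) by (simp add: flip_def)
  qed
  then show ?thesis
    by (auto simp: zone_def ineq_c_def)
qed

text \<open>Swapping \<open>i\<close> with \<open>j\<close> or \<open>k\<close> with
  \<open>l\<close> does not change the zone, so the 24 renumberings reduce to two-element
  sets.\<close>

lemma zones_c_eq: "zones_c = zone ` {S. card S = 2}"
proof
  show "zones_c \<subseteq> zone ` {S. card S = 2}"
  proof
    fix Z assume "Z \<in> zones_c"
    then obtain i j k l where r: "renumbering i j k l" and "Z = {\<epsilon> \<in> eps_cube. ineq_c i j k l \<epsilon>}"
      by (auto simp: zones_c_def)
    then have "Z = zone {i, j}"
      using zone_pair_eq by simp
    moreover have "card {i, j} = 2"
      using r by (simp add: renumbering_iff)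
    ultimately show "Z \<in> zone ` {S. card S = 2}"
      by blast
  qed
  show "zone ` {S. card S = 2} \<subseteq> zones_c"
  proof
    fix Z assume "Z \<in> zone ` {S. card S = 2}"
    then obtain S where S: "Z = zone S" "card S = 2"
      by blast
    \<comment> \<open>The complement supplies \<open>k\<close> and \<open>l\<close>, which completes
      the pair to a renumbering.\<close>
    have "card (- S) = 2"
      using S(2) card_Diff_subset[of S UNIV] by (simp add: Compl_eq_Diff_UNIV)
    then obtain k l where "- S = {k, l}" "k \<noteq> l"
      unfolding card_2_iff by blast
    moreover obtain i j where "S = {i, j}" "i \<noteq> j"
      using S(2) unfolding card_2_iff by blast
    ultimately have "renumbering i j k l" "Z = zone {i, j}"
      using S(1) by (auto simp: renumbering_iff)
    then show "Z \<in> zones_c"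
      unfolding zones_c_def using zone_pair_eq by blast
  qed
qed

lemma zones_eq: "zones = zone ` {S. even (card S)}"
  by (auto simp: zones_def zone_a_eq zone_b_eq zones_c_eq even_card_4_cases)

section \<open>Counting the zones\<close>

lemma card_pairs: "card {S :: 4 set. card S = 2} = 6"
  using n_subsets[of "UNIV :: 4 set" 2] by (simp add: binomial_fact fact_numeral choose_two)

text \<open>As \<open>zone\<close> is injective, counting zones amounts to counting the sets that
  index them.\<close>

lemma card_zones_c: "card zones_c = 6"
  by (simp add: zones_c_eq card_image[OF inj_on_subset[OF inj_zone]] card_pairs)

lemma card_zones: "card zones = 8"
proof -
  have "{S :: 4 set. even (card S)} = insert {} (insert UNIV {S. card S = 2})"
    by (auto simp: even_card_4_cases)
  then have "card {S :: 4 set. even (card S)} = 8"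
    by (simp add: card_pairs)
  then show ?thesis
    by (simp add: zones_eq card_image[OF inj_on_subset[OF inj_zone]])
qed

section \<open>Invariance and transitivity\<close>

lemma flip_image_zones:
  assumes "even (card T)" "Z \<in> zones"
  shows "flip T ` Z \<in> zones"
  using assms by (auto simp: zones_eq flip_image_zone even_card_sym_diff)

lemma bij_betw_flip_zones:
  assumes "even (card T)"
  shows "bij_betw ((`) (flip T)) zones zones"
  by (rule bij_betw_byWitness[where f' = "(`) (flip T)"])
    (use assms in \<open>auto simp: flip_image_zones image_image flip_involution\<close>)

text \<open>Reduces the invariance of the condition to that of the union of the zones.\<close>

lemma cond_iff_zones:
  assumes "\<epsilon> \<in> eps_cube"
  shows "cond_a \<epsilon> \<or> cond_b \<epsilon> \<or> cond_c \<epsilon> \<longleftrightarrow> \<epsilon> \<in> \<Union> zones"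
proof -
  have "cond_c \<epsilon> \<longleftrightarrow> \<epsilon> \<in> \<Union> zones_c"
    using assms unfolding cond_c_def zones_c_def by blast
  then show ?thesis
    using assms by (auto simp: zones_def zone_a_def zone_b_def)
qed

text \<open>A flip maps the union of the zones into itself; being an involution, it also reflects
  membership.\<close>

lemma flip_in_zones_iff:
  assumes "even (card T)"
  shows "flip T \<epsilon> \<in> \<Union> zones \<longleftrightarrow> \<epsilon> \<in> \<Union> zones"
proof -
  have "flip T \<delta> \<in> \<Union> zones" if "\<delta> \<in> \<Union> zones" for \<delta>
    using that flip_image_zones[OF assms] by blast
  then show ?thesis
    by (metis flip_involution)
qed

lemma flip_in_elem_group:
  assumes "even (card S)"
  shows "flip S \<in> elem_group"
proof -
  have pair: "flip {i, j} \<circ> g \<in> elem_group" if "g \<in> elem_group" "i \<noteq> j" for i j g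
    using elem_group_step[OF that] by (simp add: elem_pair_eq_flip)
  consider "S = {}" | "S = UNIV" | "card S = 2"
    using assms even_card_4_cases by blast
  then show ?thesis
  proof cases
    case 1
    then show ?thesis
      by (simp add: flip_empty elem_group_id)
  next
    case 2
    \<comment> \<open>The flip of all coordinates is the only even flip that needs two generators:
      two disjoint pairs cover all indices.\<close>
    have "sym_diff {1, 2} {3, 4} = (UNIV :: 4 set)"
      by (simp add: set_eq_iff forall_4)
    then have "flip S = flip {1, 2} \<circ> (flip {3, 4} \<circ> id)"
      using 2 by (auto simp: fun_eq_iff flip_flip)
    moreover have "flip {1, 2} \<circ> (flip {3, 4} \<circ> id) \<in> elem_group"
      by (intro pair elem_group_id) simp_all
    ultimately show ?thesis
      by simp
  next
    case 3
    then show ?thesis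
      using pair[OF elem_group_id] by (auto simp: card_2_iff)
  qed
qed

lemma zones_transitive:
  assumes "Z \<in> zones" "Z' \<in> zones"
  shows "\<exists>g \<in> elem_group. g ` Z = Z'"
proof -
  obtain S T where ST: "Z = zone S" "even (card S)" "Z' = zone T" "even (card T)"
    using assms by (auto simp: zones_eq)
  \<comment> \<open>The translation that carries \<open>S\<close> to \<open>T\<close> is by their
    symmetric difference, which is again even.\<close>
  have "sym_diff S (sym_diff S T) = T"
    by blast
  then have "flip (sym_diff S T) ` Z = Z'"
    by (simp add: ST flip_image_zone)
  moreover have "flip (sym_diff S T) \<in> elem_group"
    using ST by (intro flip_in_elem_group) (simp add: even_card_sym_diff)
  ultimately show ?thesis
    by blast
qed

section \<open>Elementary transformations on the weights\<close>

lemma elem_weights_parabolic: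
  "\<alpha> \<in> parabolic_weights \<Longrightarrow> elem_weights i \<alpha> \<in> parabolic_weights"
  by (auto simp: parabolic_weights_def elem_weights_def diff_less_eq)

text \<open>The difference d of the two weights at \<open>i\<close> becomes 1 - d, so its half goes
  from x to 1/2 - x. Flips along odd sets enter here, for single transformations.\<close>

lemma eps_elem_weights: "eps (elem_weights i \<alpha>) = flip {i} (eps \<alpha>)"
  by (auto simp: eps_def elem_weights_def flip_def vec_eq_iff field_simps split: prod.splits)

lemma eps_elem_weights_pair:
  assumes "i \<noteq> j"
  shows "eps (elem_weights i (elem_weights j \<alpha>)) = elem_pair i j (eps \<alpha>)"
proof -
  have "sym_diff {i} {j} = {i, j}"
    using assms by blast
  then show ?thesis
    by (simp add: eps_elem_weights flip_flip elem_pair_eq_flip)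
qed

theorem lemma5p2:
  shows "(\<forall>\<alpha> \<in> parabolic_weights. \<forall>i j. i \<noteq> j \<longrightarrow>
            elem_weights i (elem_weights j \<alpha>) \<in> parabolic_weights \<and>
            eps (elem_weights i (elem_weights j \<alpha>)) = elem_pair i j (eps \<alpha>)) \<and>
         (\<forall>\<epsilon> \<in> eps_cube. \<forall>i j. i \<noteq> j \<longrightarrow>
            elem_pair i j \<epsilon> \<in> eps_cube \<and>
            ((cond_a (elem_pair i j \<epsilon>) \<or> cond_b (elem_pair i j \<epsilon>) \<or> cond_c (elem_pair i j \<epsilon>))
               \<longleftrightarrow> (cond_a \<epsilon> \<or> cond_b \<epsilon> \<or> cond_c \<epsilon>))) \<and>
         card zones_c = 6 \<and>
         card zones = 8 \<and>
         (\<forall>i j. i \<noteq> j \<longrightarrow> bij_betw ((`) (elem_pair i j)) zones zones) \<and>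
         (\<forall>Z \<in> zones. \<forall>Z' \<in> zones. \<exists>g \<in> elem_group. g ` Z = Z')"
proof (intro conjI ballI allI impI)
  fix i j :: 4 assume ij: "i \<noteq> j"
  then have even: "even (card {i, j})"
    by simp
  show "elem_weights i (elem_weights j \<alpha>) \<in> parabolic_weights" if "\<alpha> \<in> parabolic_weights" for \<alpha>
    using that by (intro elem_weights_parabolic)
  show "eps (elem_weights i (elem_weights j \<alpha>)) = elem_pair i j (eps \<alpha>)" for \<alpha>
    using ij by (rule eps_elem_weights_pair)
  show cube: "elem_pair i j \<epsilon> \<in> eps_cube" if "\<epsilon> \<in> eps_cube" for \<epsilon>
    using that by (simp add: elem_pair_eq_flip flip_in_cube)
  show "(cond_a (elem_pair i j \<epsilon>) \<or> cond_b (elem_pair i j \<epsilon>) \<or> cond_c (elem_pair i j \<epsilon>))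
      \<longleftrightarrow> (cond_a \<epsilon> \<or> cond_b \<epsilon> \<or> cond_c \<epsilon>)" if "\<epsilon> \<in> eps_cube" for \<epsilon>
    unfolding cond_iff_zones[OF that] cond_iff_zones[OF cube[OF that]]
    unfolding elem_pair_eq_flip by (rule flip_in_zones_iff[OF even])
  show "bij_betw ((`) (elem_pair i j)) zones zones"
    unfolding elem_pair_eq_flip by (rule bij_betw_flip_zones[OF even])
qed (simp_all add: card_zones_c card_zones zones_transitive)

end
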